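(* Let $n$ be a positive integer and let the dihedral group $D_n=\langle \rho,\sigma\mid \rho^n=1,\ \sigma^2=1,\ \rho^k\sigma=\sigma\rho^{-k}\rangle$ (of order $2n$) act on $\mathbb{Z}_{2n}$ by $\rho^k\cdot x=x+2k$ and $\sigma\cdot x=-x$. Let $\widehat{Aut(D_n)^S}$ be the group of $S$-invariant functions of this action. Then $$\widehat{Aut(D_n)^S}\;\cong\;\langle T_1\rangle\rtimes\langle f_\nu \mid \nu\in U(\mathbb{Z}_{2n})\rangle\;\cong\;\mathbb{Z}_{2n}\rtimes GL(\mathbb{Z}_{2n})=Aff(\mathbb{Z}_{2n}),$$ and moreover $\big|\widehat{Aut(D_n)^S}\big|=2n\,\varphi(2n)$, where $\varphi$ is Euler's totient function.
   Context: Given a finite group $G$ acting on a finite nonempty set $X$ and $\phi\in Aut(G)$, a bijection $f:X\to X$ is called $\phi$-invariant if $f(g\cdot x)=\phi(g)\cdot f(x)$ for all $g\in G$, $x\in X$. The group of $S$-invariant functions $\widehat{Aut(G)^S}$ is the subgroup of $Sym(X)$ consisting of all bijections $f$ that are $\phi$-invariant for some $\phi\in Aut(G)$. Here $G=D_n$ and $X=\mathbb{Z}_{2n}$. For $k\in\mathbb{Z}_{2n}$, $T_k:\mathbb{Z}_{2n}\to\mathbb{Z}_{2n}$ is the translation $x\mapsto x+k$; for $\nu\in U(\mathbb{Z}_{2n})$ (the group of units), $f_\nu$ is the map $x\mapsto \nu x$. $GL(\mathbb{Z}_{2n})$ is the group of invertible linear maps $x\mapsto\nu x$ of $\mathbb{Z}_{2n}$,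 and $Aff(\mathbb{Z}_{2n})$ is the group of affine bijections $x\mapsto\nu x+k$. *)

theory Defs
  imports "HOL-Algebra.Group_Action" "HOL-Algebra.Generated_Groups" "HOL-Number_Theory.Residues"
begin

section \<open>Groups of \<open>S\<close>-invariant functions\<close>

definition twisted_invariant ::
    "('g, 'c) monoid_scheme \<Rightarrow> 'x set \<Rightarrow> ('g \<Rightarrow> 'x \<Rightarrow> 'x) \<Rightarrow> ('g \<Rightarrow> 'g) \<Rightarrow> ('x \<Rightarrow> 'x) \<Rightarrow> bool" where
  "twisted_invariant G E act \<alpha> f \<longleftrightarrow>
     (\<forall>g\<in>carrier G. \<forall>x\<in>E. f (act g x) = act (\<alpha> g) (f x))"

definition S_invariant_group ::
    "('g, 'c) monoid_scheme \<Rightarrow> 'x set \<Rightarrow> ('g \<Rightarrow> 'x \<Rightarrow> 'x) \<Rightarrow> ('x \<Rightarrow> 'x) monoid" where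
  "S_invariant_group G E act =
     (BijGroup E)\<lparr>carrier := {f \<in> Bij E. \<exists>\<alpha>\<in>auto G. twisted_invariant G E act \<alpha> f}\<rparr>"

section \<open>The dihedral group of order \<open>2n\<close>\<close>

text \<open>
  The pair \<open>(a, s)\<close> stands for \<open>\<rho>\<^sup>a\<close> if \<open>s\<close> is false and for \<open>\<rho>\<^sup>a \<sigma>\<close> if \<open>s\<close> is true.
  The lemmas below show that for \<open>n > 0\<close> this is a group of order \<open>2n\<close> with the presentation
  \<open>\<langle>\<rho>, \<sigma> | \<rho>\<^sup>n = 1, \<sigma>\<^sup>2 = 1, \<rho>\<^sup>k \<sigma> = \<sigma> \<rho>\<^sup>-\<^sup>k\<rangle>\<close>.
\<close>
definition dihedral :: "nat \<Rightarrow> (int \<times> bool) monoid" where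
  "dihedral n =
     \<lparr>carrier = {0..<int n} \<times> UNIV,
      monoid.mult = (\<lambda>(a, s) (b, t). ((if s then a - b else a + b) mod int n, s \<noteq> t)),
      one = (0, False)\<rparr>"

definition rho :: "nat \<Rightarrow> int \<times> bool" where "rho n = (1 mod int n, False)"
definition sigma :: "int \<times> bool" where "sigma = (0, True)"

lemma dihedral_simps:
  "carrier (dihedral n) = {0..<int n} \<times> UNIV"
  "\<one>\<^bsub>dihedral n\<^esub> = (0, False)"
  "(a, s) \<otimes>\<^bsub>dihedral n\<^esub> (b, t) = ((if s then a - b else a + b) mod int n, s \<noteq> t)"
  by (simp_all add: dihedral_def)

lemma order_dihedral: "order (dihedral n) = 2 * n"
  by (simp add: order_def dihedral_simps card_cartesian_product)

lemma group_dihedral: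
  assumes "n > 0" shows "group (dihedral n)"
proof (rule groupI)
  fix x assume "x \<in> carrier (dihedral n)"
  then show "\<exists>y\<in>carrier (dihedral n). y \<otimes>\<^bsub>dihedral n\<^esub> x = \<one>\<^bsub>dihedral n\<^esub>"
    using assms
    by (intro bexI[of _ "(if snd x then fst x else (- fst x) mod int n, snd x)"])
       (auto simp: dihedral_simps mod_simps split: prod.splits)
qed (use assms in \<open>auto simp: dihedral_simps mod_simps algebra_simps\<close>)

lemma rho_sigma_carrier:
  assumes "n > 0" shows "rho n \<in> carrier (dihedral n)" "sigma \<in> carrier (dihedral n)"
  using assms by (auto simp: dihedral_simps rho_def sigma_def)

lemma rho_pow_nat:
  assumes "n > 0" shows "rho n [^]\<^bsub>dihedral n\<^esub> (k::nat) = (int k mod int n, False)"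
proof -
  interpret group "dihedral n" by (rule group_dihedral) fact
  show ?thesis
    by (induction k) (auto simp: dihedral_simps rho_def mod_simps algebra_simps)
qed

lemma rho_pow:
  assumes "n > 0" shows "rho n [^]\<^bsub>dihedral n\<^esub> (k::int) = (k mod int n, False)"
proof -
  interpret group "dihedral n" by (rule group_dihedral) fact
  have "inv\<^bsub>dihedral n\<^esub> (- k mod int n, False) = (k mod int n, False)"
    using assms by (intro inv_equality) (auto simp: dihedral_simps mod_simps)
  then show ?thesis
    unfolding int_pow_def2 rho_pow_nat[OF assms] by simp
qed

lemma dihedral_relations:
  assumes "n > 0"
  shows "rho n [^]\<^bsub>dihedral n\<^esub> n = \<one>\<^bsub>dihedral n\<^esub>"
    and "sigma [^]\<^bsub>dihedral n\<^esub> (2::nat) = \<one>\<^bsub>dihedral n\<^esub>"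
    and "rho n [^]\<^bsub>dihedral n\<^esub> k \<otimes>\<^bsub>dihedral n\<^esub> sigma =
         sigma \<otimes>\<^bsub>dihedral n\<^esub> rho n [^]\<^bsub>dihedral n\<^esub> (- k :: int)"
proof -
  interpret group "dihedral n" by (rule group_dihedral) fact
  show "rho n [^]\<^bsub>dihedral n\<^esub> n = \<one>\<^bsub>dihedral n\<^esub>"
    using assms by (simp add: rho_pow_nat dihedral_simps)
  show "sigma [^]\<^bsub>dihedral n\<^esub> (2::nat) = \<one>\<^bsub>dihedral n\<^esub>"
    by (simp add: numeral_2_eq_2 sigma_def dihedral_simps)
  show "rho n [^]\<^bsub>dihedral n\<^esub> k \<otimes>\<^bsub>dihedral n\<^esub> sigma =
        sigma \<otimes>\<^bsub>dihedral n\<^esub> rho n [^]\<^bsub>dihedral n\<^esub> (- k)"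
    using assms by (simp add: rho_pow sigma_def dihedral_simps mod_simps)
qed

lemma dihedral_normal_form:
  assumes "n > 0" "(a, s) \<in> carrier (dihedral n)"
  shows "(a, s) = rho n [^]\<^bsub>dihedral n\<^esub> a \<otimes>\<^bsub>dihedral n\<^esub> (if s then sigma else \<one>\<^bsub>dihedral n\<^esub>)"
  using assms by (auto simp: rho_pow dihedral_simps sigma_def)

lemma dihedral_generated:
  assumes "n > 0"
  shows "generate (dihedral n) {rho n, sigma} = carrier (dihedral n)"
proof -
  interpret group "dihedral n" by (rule group_dihedral) fact
  have S: "{rho n, sigma} \<subseteq> carrier (dihedral n)"
    using rho_sigma_carrier[OF assms] by blast
  then interpret H: subgroup "generate (dihedral n) {rho n, sigma}" "dihedral n"
    by (rule generate_is_subgroup)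
  have gens: "rho n \<in> generate (dihedral n) {rho n, sigma}"
             "sigma \<in> generate (dihedral n) {rho n, sigma}"
    by (auto intro: generate.incl)
  have "(a, s) \<in> generate (dihedral n) {rho n, sigma}"
    if as: "(a, s) \<in> carrier (dihedral n)" for a s
  proof -
    have "rho n [^]\<^bsub>dihedral n\<^esub> a \<in> generate (dihedral n) {rho n, sigma}"
      by (rule subgroup_int_pow_closed[OF H.subgroup_axioms gens(1)])
    then show ?thesis
      using gens(2) by (subst dihedral_normal_form[OF assms as]) auto
  qed
  then show ?thesis using H.subset by auto
qed

lemma dihedral_universal:
  assumes "n > 0" "group H" "r \<in> carrier H" "s \<in> carrier H"
    and rn: "r [^]\<^bsub>H\<^esub> n = \<one>\<^bsub>H\<^esub>" and s2: "s [^]\<^bsub>H\<^esub> (2::nat) = \<one>\<^bsub>H\<^esub>"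
    and rs: "\<And>k::int. r [^]\<^bsub>H\<^esub> k \<otimes>\<^bsub>H\<^esub> s = s \<otimes>\<^bsub>H\<^esub> r [^]\<^bsub>H\<^esub> (- k)"
  shows "\<exists>h\<in>hom (dihedral n) H. h (rho n) = r \<and> h sigma = s"
proof -
  interpret group H by fact
  note [simp] = assms(3,4)
  have ss: "s \<otimes>\<^bsub>H\<^esub> s = \<one>\<^bsub>H\<^esub>"
    using s2 by (simp add: numeral_2_eq_2)
  have red: "r [^]\<^bsub>H\<^esub> (a mod int n) = r [^]\<^bsub>H\<^esub> a" for a
  proof -
    have "r [^]\<^bsub>H\<^esub> a = r [^]\<^bsub>H\<^esub> (int n * (a div int n)) \<otimes>\<^bsub>H\<^esub> r [^]\<^bsub>H\<^esub> (a mod int n)"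
      by (simp flip: int_pow_mult)
    also have "r [^]\<^bsub>H\<^esub> (int n * (a div int n)) = \<one>\<^bsub>H\<^esub>"
      using rn by (simp add: int_pow_int flip: int_pow_pow)
    finally show ?thesis by simp
  qed
  define h where "h = (\<lambda>(a::int, t). r [^]\<^bsub>H\<^esub> a \<otimes>\<^bsub>H\<^esub> (if t then s else \<one>\<^bsub>H\<^esub>))"
  have sr: "s \<otimes>\<^bsub>H\<^esub> r [^]\<^bsub>H\<^esub> b = r [^]\<^bsub>H\<^esub> (- b) \<otimes>\<^bsub>H\<^esub> s" for b :: int
    using rs[of "- b"] by simp
  have sr': "s \<otimes>\<^bsub>H\<^esub> (r [^]\<^bsub>H\<^esub> b \<otimes>\<^bsub>H\<^esub> x) = r [^]\<^bsub>H\<^esub> (- b) \<otimes>\<^bsub>H\<^esub> (s \<otimes>\<^bsub>H\<^esub> x)"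
    if "x \<in> carrier H" for b :: int and x
    using that sr[of b] by (simp flip: m_assoc)
  have cmb: "r [^]\<^bsub>H\<^esub> a \<otimes>\<^bsub>H\<^esub> (r [^]\<^bsub>H\<^esub> b \<otimes>\<^bsub>H\<^esub> x) = r [^]\<^bsub>H\<^esub> (a + b) \<otimes>\<^bsub>H\<^esub> x"
    if "x \<in> carrier H" for a b :: int and x
    using that by (simp add: int_pow_mult m_assoc)
  have "h \<in> hom (dihedral n) H"
    by (rule homI)
       (auto simp: h_def dihedral_simps red m_assoc sr sr' cmb ss
             simp flip: int_pow_mult)
  moreover have "h (rho n) = r" "h sigma = s"
    by (simp_all add: h_def rho_def sigma_def red)
  ultimately show ?thesis by blast
qed

section \<open>The action on \<open>\<int>\<^sub>2\<^sub>n\<close>\<close>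

abbreviation Z2n :: "nat \<Rightarrow> int ring" where
  "Z2n n \<equiv> residue_ring (2 * int n)"

definition dihedral_act :: "nat \<Rightarrow> int \<times> bool \<Rightarrow> int \<Rightarrow> int" where
  "dihedral_act n = (\<lambda>(a, s). \<lambda>x\<in>carrier (Z2n n).
     ((if s then - x else x) + 2 * a) mod (2 * int n))"

lemma add_double_mod: "(x + 2 * (k mod m)) mod (2 * m) = (x + 2 * k) mod (2 * m)" for m :: int
  by (metis mod_add_right_eq mult_mod_right)

lemma dihedral_act_rho:
  assumes "n > 0" "x \<in> carrier (Z2n n)"
  shows "dihedral_act n (rho n [^]\<^bsub>dihedral n\<^esub> (k::int)) x = (x + 2 * k) mod (2 * int n)"
  using assms by (simp add: dihedral_act_def rho_pow add_double_mod)

lemma dihedral_act_sigma: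
  assumes "x \<in> carrier (Z2n n)"
  shows "dihedral_act n sigma x = (- x) mod (2 * int n)"
  using assms by (simp add: dihedral_act_def sigma_def)

lemma group_action_dihedral_act:
  assumes "n > 0"
  shows "group_action (dihedral n) (carrier (Z2n n)) (dihedral_act n)"
proof -
  let ?E = "carrier (Z2n n)" and ?m = "2 * int n"
  have E: "?E = {0..<?m}"
    by (auto simp: residue_ring_def)
  have cl: "dihedral_act n g x \<in> ?E" if "x \<in> ?E" for g x
    using that assms by (auto simp: dihedral_act_def E split: prod.splits)
  have comp: "dihedral_act n (g \<otimes>\<^bsub>dihedral n\<^esub> h) x = dihedral_act n g (dihedral_act n h x)"
    if "x \<in> ?E" for g h x
  proof -
    obtain a s b t where [simp]: "g = (a, s)" "h = (b, t)" by fastforce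
    let ?b = "(if t then - x else x) + 2 * b"
    have "dihedral_act n (g \<otimes>\<^bsub>dihedral n\<^esub> h) x =
          ((if s \<noteq> t then - x else x) + 2 * (if s then a - b else a + b)) mod ?m"
      using that by (simp add: dihedral_act_def dihedral_simps add_double_mod)
    also have "\<dots> = ((if s then - ?b else ?b) + 2 * a) mod ?m"
      by (simp add: algebra_simps)
    also have "\<dots> = ((if s then - (?b mod ?m) else ?b mod ?m) + 2 * a) mod ?m"
      by (cases s) (simp only: if_True, metis mod_add_left_eq mod_minus_eq,
                    simp only: if_False, metis mod_add_left_eq)
    also have "\<dots> = dihedral_act n g (dihedral_act n h x)"
      using that cl[OF that, of h] by (simp add: dihedral_act_def)
    finally show ?thesis .
  qed
  interpret group "dihedral n" by (rule group_dihedral) fact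
  have one: "dihedral_act n \<one>\<^bsub>dihedral n\<^esub> x = x" if "x \<in> ?E" for x
    using that by (auto simp: dihedral_act_def dihedral_simps E)
  have bij: "dihedral_act n g \<in> Bij ?E" if g: "g \<in> carrier (dihedral n)" for g
  proof -
    have "bij_betw (dihedral_act n g) ?E ?E"
      by (rule bij_betw_byWitness[of _ "dihedral_act n (inv\<^bsub>dihedral n\<^esub> g)"])
         (use g in \<open>auto intro: cl simp: one simp flip: comp\<close>)
    then show ?thesis
      by (auto simp: Bij_def dihedral_act_def split: prod.splits)
  qed
  have "dihedral_act n \<in> hom (dihedral n) (BijGroup ?E)"
  proof (rule homI)
    fix g h assume gh: "g \<in> carrier (dihedral n)" "h \<in> carrier (dihedral n)"
    have "dihedral_act n (g \<otimes>\<^bsub>dihedral n\<^esub> h) = compose ?E (dihedral_act n g) (dihedral_act n h)"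
    proof
      fix x show "dihedral_act n (g \<otimes>\<^bsub>dihedral n\<^esub> h) x =
                  compose ?E (dihedral_act n g) (dihedral_act n h) x"
        by (cases "x \<in> ?E")
           (simp_all add: compose_def comp, simp add: dihedral_act_def split: prod.splits)
    qed
    then show "dihedral_act n (g \<otimes>\<^bsub>dihedral n\<^esub> h) =
               dihedral_act n g \<otimes>\<^bsub>BijGroup ?E\<^esub> dihedral_act n h"
      using gh by (simp add: BijGroup_def bij)
  qed (simp add: BijGroup_def bij)
  then show ?thesis
    by (simp add: group_action_def group_hom_def group_hom_axioms_def group_BijGroup group_axioms)
qed

definition dihedral_S_invariant_group :: "nat \<Rightarrow> (int \<Rightarrow> int) monoid" where
  "dihedral_S_invariant_group n =
     S_invariant_group (dihedral n) (carrier (Z2n n)) (dihedral_act n)"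

section \<open>Semidirect products\<close>

text \<open>
  The ingredients of a semidirect product \<open>N \<rtimes> H\<close>: \<open>H\<close> acts on \<open>N\<close> by group automorphisms.
\<close>
definition semidirect_data ::
    "('a, 'c) monoid_scheme \<Rightarrow> ('b, 'd) monoid_scheme \<Rightarrow> ('b \<Rightarrow> 'a \<Rightarrow> 'a) \<Rightarrow> bool" where
  "semidirect_data N H \<theta> \<longleftrightarrow> group N \<and> group H \<and> \<theta> \<in> hom H (AutoGroup N)"

definition semidirect ::
    "('a, 'c) monoid_scheme \<Rightarrow> ('b, 'd) monoid_scheme \<Rightarrow> ('b \<Rightarrow> 'a \<Rightarrow> 'a) \<Rightarrow> ('a \<times> 'b) monoid" where
  "semidirect N H \<theta> =
     \<lparr>carrier = carrier N \<times> carrier H,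
      monoid.mult = (\<lambda>(a, h) (b, k). (a \<otimes>\<^bsub>N\<^esub> \<theta> h b, h \<otimes>\<^bsub>H\<^esub> k)),
      one = (\<one>\<^bsub>N\<^esub>, \<one>\<^bsub>H\<^esub>)\<rparr>"

definition conjugation :: "('a, 'c) monoid_scheme \<Rightarrow> 'a set \<Rightarrow> 'a \<Rightarrow> 'a \<Rightarrow> 'a" where
  "conjugation G N h = (\<lambda>a\<in>N. h \<otimes>\<^bsub>G\<^esub> a \<otimes>\<^bsub>G\<^esub> inv\<^bsub>G\<^esub> h)"

section \<open>Affine maps of \<open>\<int>\<^sub>2\<^sub>n\<close>\<close>

text \<open>Bijections are represented by extensional functions, as in \<^const>\<open>BijGroup\<close>.\<close>

definition translation :: "nat \<Rightarrow> int \<Rightarrow> int \<Rightarrow> int" where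
  "translation n k = (\<lambda>x\<in>carrier (Z2n n). x \<oplus>\<^bsub>Z2n n\<^esub> k)"

definition scaling :: "nat \<Rightarrow> int \<Rightarrow> int \<Rightarrow> int" where
  "scaling n \<nu> = (\<lambda>x\<in>carrier (Z2n n). \<nu> \<otimes>\<^bsub>Z2n n\<^esub> x)"

definition GL :: "nat \<Rightarrow> (int \<Rightarrow> int) monoid" where
  "GL n = (BijGroup (carrier (Z2n n)))
     \<lparr>carrier := {f \<in> Bij (carrier (Z2n n)). \<exists>\<nu>\<in>carrier (Z2n n). f = scaling n \<nu>}\<rparr>"

definition Aff :: "nat \<Rightarrow> (int \<Rightarrow> int) monoid" where
  "Aff n = (BijGroup (carrier (Z2n n)))
     \<lparr>carrier := {f \<in> Bij (carrier (Z2n n)). \<exists>\<nu>\<in>carrier (Z2n n). \<exists>k\<in>carrier (Z2n n).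
        f = (\<lambda>x\<in>carrier (Z2n n). \<nu> \<otimes>\<^bsub>Z2n n\<^esub> x \<oplus>\<^bsub>Z2n n\<^esub> k)}\<rparr>"

definition translation_group :: "nat \<Rightarrow> (int \<Rightarrow> int) monoid" where
  "translation_group n = subgroup_generated (BijGroup (carrier (Z2n n))) {translation n 1}"

definition scaling_group :: "nat \<Rightarrow> (int \<Rightarrow> int) monoid" where
  "scaling_group n =
     subgroup_generated (BijGroup (carrier (Z2n n))) {scaling n \<nu> | \<nu>. \<nu> \<in> Units (Z2n n)}"

text \<open>\<open>\<langle>T\<^sub>1\<rangle> \<rtimes> \<langle>f\<^sub>\<nu>\<rangle>\<close>, where \<open>\<langle>f\<^sub>\<nu>\<rangle>\<close> acts by conjugation inside the symmetric group.\<close>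
abbreviation scaling_conj :: "nat \<Rightarrow> (int \<Rightarrow> int) \<Rightarrow> (int \<Rightarrow> int) \<Rightarrow> int \<Rightarrow> int" where
  "scaling_conj n \<equiv> conjugation (BijGroup (carrier (Z2n n))) (carrier (translation_group n))"

text \<open>
  The tautological action of \<^const>\<open>GL\<close> on the additive group, and the usual identification of
  \<open>\<int>\<^sub>2\<^sub>n \<rtimes> GL(\<int>\<^sub>2\<^sub>n)\<close> with affine maps: \<open>(k, g)\<close> is \<open>x \<mapsto> g x + k\<close>.
\<close>
abbreviation Z2n_semidirect_GL :: "nat \<Rightarrow> (int \<times> (int \<Rightarrow> int)) monoid" where
  "Z2n_semidirect_GL n \<equiv> semidirect (add_monoid (Z2n n)) (GL n) (\<lambda>g. g)"

definition to_affine :: "nat \<Rightarrow> int \<times> (int \<Rightarrow> int) \<Rightarrow> int \<Rightarrow> int" where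
  "to_affine n = (\<lambda>(k, g). \<lambda>x\<in>carrier (Z2n n). g x \<oplus>\<^bsub>Z2n n\<^esub> k)"

end

theory Submission
  imports Defs
begin

text \<open>
  The group of \<open>S\<close>-invariant functions is not merely isomorphic to the affine group: the two
  are the same set of bijections of \<open>\<int>\<^sub>2\<^sub>n\<close>.

  If \<open>f\<close> is invariant with respect to an automorphism \<open>\<alpha>\<close>, looking at fixed points shows that
  \<open>\<alpha>\<close> sends \<open>\<rho>\<close> to a rotation and \<open>\<sigma>\<close> to a reflection. The first makes \<open>f\<close> an arithmetic
  progression on the even and on the odd residues separately; the second forces the two
  progressions to fit together, so that \<open>f x = \<nu> x + k\<close> with \<open>\<nu> = f 1 - f 0\<close> and \<open>k = f 0\<close>
  (lemma \<open>invariant_imp_affine\<close>), and bijectivity of \<open>f\<close> makes \<open>\<nu>\<close> a unit. Conversely an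
  affine bijection conjugates rotations to rotations and reflections to reflections, and the
  induced map of the dihedral group is an automorphism (lemma \<open>affine_invariant\<close>).

  What remains is the structure of the affine group. Every affine bijection is a translation
  after a scaling; the scalings normalise the translations and meet them trivially. So the
  affine group is the internal semidirect product of the two subgroups
  (lemma \<open>iso_internal_semidirect\<close>). The external description by pairs \<open>(k, g)\<close> is matched
  with it by \<^const>\<open>to_affine\<close>. An affine bijection determines \<open>\<nu>\<close> and \<open>k\<close>, which are a
  unit and an arbitrary residue, and this gives the order.
\<close>

section \<open>Semidirect products\<close>

lemma semidirect_data_apply:
  assumes "semidirect_data N H \<theta>"
  shows "\<And>h. h \<in> carrier H \<Longrightarrow> \<theta> h \<in> hom N N"
    and "\<And>h. h \<in> carrier H \<Longrightarrow> bij_betw (\<theta> h) (carrier N) (carrier N)"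
    and "\<And>h k a. \<lbrakk>h \<in> carrier H; k \<in> carrier H; a \<in> carrier N\<rbrakk>
           \<Longrightarrow> \<theta> (h \<otimes>\<^bsub>H\<^esub> k) a = \<theta> h (\<theta> k a)"
    and "\<And>a. a \<in> carrier N \<Longrightarrow> \<theta> \<one>\<^bsub>H\<^esub> a = a"
proof -
  have N: "group N" and H: "group H" and \<theta>: "\<theta> \<in> hom H (AutoGroup N)"
    using assms by (auto simp: semidirect_data_def)
  have aut: "\<theta> h \<in> auto N" if "h \<in> carrier H" for h
    using hom_in_carrier[OF \<theta> that] by (simp add: AutoGroup_def)
  show "\<And>h. h \<in> carrier H \<Longrightarrow> \<theta> h \<in> hom N N"
    and "\<And>h. h \<in> carrier H \<Longrightarrow> bij_betw (\<theta> h) (carrier N) (carrier N)"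
    using aut by (auto simp: auto_def Bij_def)
  show "\<theta> (h \<otimes>\<^bsub>H\<^esub> k) a = \<theta> h (\<theta> k a)"
    if "h \<in> carrier H" "k \<in> carrier H" "a \<in> carrier N" for h k a
    using hom_mult[OF \<theta> that(1,2)] aut[OF that(1)] aut[OF that(2)] that(3)
    by (simp add: AutoGroup_def BijGroup_def auto_def compose_eq)
  show "\<theta> \<one>\<^bsub>H\<^esub> a = a" if "a \<in> carrier N" for a
    using hom_one[OF \<theta> H group.AutoGroup[OF N]] that
    by (simp add: AutoGroup_def BijGroup_def)
qed

lemma group_semidirect:
  assumes "semidirect_data N H \<theta>"
  shows "group (semidirect N H \<theta>)"
proof -
  interpret N: group N using assms by (simp add: semidirect_data_def)
  interpret H: group H using assms by (simp add: semidirect_data_def)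
  note \<theta> = semidirect_data_apply[OF assms]
  note \<theta>_mem [simp] = hom_in_carrier[OF \<theta>(1)] and \<theta>_mult = hom_mult[OF \<theta>(1)]
  note \<theta>_one [simp] = hom_one[OF \<theta>(1) N.group_axioms N.group_axioms]
  show ?thesis
  proof (rule groupI)
    fix x assume "x \<in> carrier (semidirect N H \<theta>)"
    then obtain a h where x: "x = (a, h)" "a \<in> carrier N" "h \<in> carrier H"
      by (auto simp: semidirect_def)
    let ?y = "(\<theta> (inv\<^bsub>H\<^esub> h) (inv\<^bsub>N\<^esub> a), inv\<^bsub>H\<^esub> h)"
    have "?y \<otimes>\<^bsub>semidirect N H \<theta>\<^esub> x = \<one>\<^bsub>semidirect N H \<theta>\<^esub>"
      using x by (simp add: semidirect_def flip: \<theta>_mult)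
    moreover have "?y \<in> carrier (semidirect N H \<theta>)"
      using x by (simp add: semidirect_def)
    ultimately show "\<exists>y\<in>carrier (semidirect N H \<theta>).
        y \<otimes>\<^bsub>semidirect N H \<theta>\<^esub> x = \<one>\<^bsub>semidirect N H \<theta>\<^esub>" by blast
  qed (auto simp: semidirect_def \<theta>_mult \<theta>(3,4) N.m_assoc H.m_assoc)
qed

text \<open>
  Conjugation by \<open>h\<close> maps \<open>N\<close> onto \<open>N\<close>, and not only into it, because conjugation by the
  inverse of \<open>h\<close> preserves \<open>N\<close> as well.
\<close>
lemma semidirect_data_conjugation:
  assumes "group G" "subgroup N G" "subgroup H G"
    and conj: "\<And>h a. \<lbrakk>h \<in> H; a \<in> N\<rbrakk> \<Longrightarrow> h \<otimes>\<^bsub>G\<^esub> a \<otimes>\<^bsub>G\<^esub> inv\<^bsub>G\<^esub> h \<in> N"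
  shows "semidirect_data (G\<lparr>carrier := N\<rparr>) (G\<lparr>carrier := H\<rparr>) (conjugation G N)"
proof -
  interpret group G by fact
  interpret N: subgroup N G by fact
  interpret H: subgroup H G by fact
  have comp: "(h \<otimes>\<^bsub>G\<^esub> k) \<otimes>\<^bsub>G\<^esub> a \<otimes>\<^bsub>G\<^esub> inv\<^bsub>G\<^esub> (h \<otimes>\<^bsub>G\<^esub> k) =
      h \<otimes>\<^bsub>G\<^esub> (k \<otimes>\<^bsub>G\<^esub> a \<otimes>\<^bsub>G\<^esub> inv\<^bsub>G\<^esub> k) \<otimes>\<^bsub>G\<^esub> inv\<^bsub>G\<^esub> h"
    if "h \<in> H" "k \<in> H" "a \<in> N" for h k a
    using that by (simp add: inv_mult_group m_assoc)
  have cancel: "inv\<^bsub>G\<^esub> h \<otimes>\<^bsub>G\<^esub> (h \<otimes>\<^bsub>G\<^esub> x) = x" if "h \<in> H" "x \<in> carrier G" for h x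
    using that by (simp flip: m_assoc)
  have cancel': "h \<otimes>\<^bsub>G\<^esub> (inv\<^bsub>G\<^esub> h \<otimes>\<^bsub>G\<^esub> x) = x" if "h \<in> H" "x \<in> carrier G" for h x
    using that by (simp flip: m_assoc)
  have maps: "conjugation G N h ` N \<subseteq> N" if "h \<in> H" for h
  proof (rule image_subsetI)
    show "conjugation G N h a \<in> N" if a: "a \<in> N" for a
      using conj[OF \<open>h \<in> H\<close> a] a by (simp add: conjugation_def)
  qed
  have aut: "conjugation G N h \<in> auto (G\<lparr>carrier := N\<rparr>)" if h: "h \<in> H" for h
  proof -
    have "conjugation G N h \<in> hom (G\<lparr>carrier := N\<rparr>) (G\<lparr>carrier := N\<rparr>)"
    proof (rule homI)
      fix a b assume "a \<in> carrier (G\<lparr>carrier := N\<rparr>)" "b \<in> carrier (G\<lparr>carrier := N\<rparr>)"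
      then have "a \<in> N" "b \<in> N" by auto
      moreover from this have "h \<otimes>\<^bsub>G\<^esub> (a \<otimes>\<^bsub>G\<^esub> b) \<otimes>\<^bsub>G\<^esub> inv\<^bsub>G\<^esub> h =
          (h \<otimes>\<^bsub>G\<^esub> a \<otimes>\<^bsub>G\<^esub> inv\<^bsub>G\<^esub> h) \<otimes>\<^bsub>G\<^esub> (h \<otimes>\<^bsub>G\<^esub> b \<otimes>\<^bsub>G\<^esub> inv\<^bsub>G\<^esub> h)"
        using h cancel[of h] by (simp add: m_assoc)
      ultimately show "conjugation G N h (a \<otimes>\<^bsub>G\<lparr>carrier := N\<rparr>\<^esub> b) =
          conjugation G N h a \<otimes>\<^bsub>G\<lparr>carrier := N\<rparr>\<^esub> conjugation G N h b"
        by (simp add: conjugation_def)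
    qed (simp add: conjugation_def conj h)
    moreover have "bij_betw (conjugation G N h) N N"
    proof (rule bij_betw_byWitness[where f' = "conjugation G N (inv\<^bsub>G\<^esub> h)"])
      show "\<forall>a\<in>N. conjugation G N (inv\<^bsub>G\<^esub> h) (conjugation G N h a) = a"
      proof
        fix a assume a: "a \<in> N"
        have "inv\<^bsub>G\<^esub> h \<otimes>\<^bsub>G\<^esub> (h \<otimes>\<^bsub>G\<^esub> a \<otimes>\<^bsub>G\<^esub> inv\<^bsub>G\<^esub> h) \<otimes>\<^bsub>G\<^esub> h = a"
          using h a by (simp add: m_assoc cancel)
        then show "conjugation G N (inv\<^bsub>G\<^esub> h) (conjugation G N h a) = a"
          using h a by (simp add: conjugation_def conj)
      qed
      show "\<forall>a\<in>N. conjugation G N h (conjugation G N (inv\<^bsub>G\<^esub> h) a) = a"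
      proof
        fix a assume a: "a \<in> N"
        have "h \<otimes>\<^bsub>G\<^esub> (inv\<^bsub>G\<^esub> h \<otimes>\<^bsub>G\<^esub> a \<otimes>\<^bsub>G\<^esub> h) \<otimes>\<^bsub>G\<^esub> inv\<^bsub>G\<^esub> h = a"
          using h a by (simp add: m_assoc cancel')
        then show "conjugation G N h (conjugation G N (inv\<^bsub>G\<^esub> h) a) = a"
          using h a conj[OF H.m_inv_closed[OF h] a] by (simp add: conjugation_def)
      qed
      show "conjugation G N h ` N \<subseteq> N" "conjugation G N (inv\<^bsub>G\<^esub> h) ` N \<subseteq> N"
        using maps h by simp_all
    qed
    ultimately show ?thesis
      by (simp add: auto_def Bij_def conjugation_def)
  qed
  have "conjugation G N \<in> hom (G\<lparr>carrier := H\<rparr>) (AutoGroup (G\<lparr>carrier := N\<rparr>))"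
  proof (rule homI)
    fix h k assume "h \<in> carrier (G\<lparr>carrier := H\<rparr>)" "k \<in> carrier (G\<lparr>carrier := H\<rparr>)"
    then have hk: "h \<in> H" "k \<in> H" by auto
    have "conjugation G N (h \<otimes>\<^bsub>G\<^esub> k) = compose N (conjugation G N h) (conjugation G N k)"
      unfolding conjugation_def compose_def
      by (rule restrict_ext) (simp add: hk conj comp)
    then show "conjugation G N (h \<otimes>\<^bsub>G\<lparr>carrier := H\<rparr>\<^esub> k) =
        conjugation G N h \<otimes>\<^bsub>AutoGroup (G\<lparr>carrier := N\<rparr>)\<^esub> conjugation G N k"
      using aut[OF hk(1)] aut[OF hk(2)] by (simp add: AutoGroup_def BijGroup_def auto_def)
  qed (simp add: AutoGroup_def aut)
  then show ?thesis
    by (simp add: semidirect_data_def subgroup_imp_group assms)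
qed

text \<open>
  The multiplication rule of the semidirect product is the identity
  \<open>a h b k = a (h b h\<inverse>) h k\<close>; injectivity is uniqueness of the factorisation \<open>a h\<close>, which
  amounts to \<open>N\<close> and \<open>H\<close> meeting trivially.
\<close>
lemma iso_internal_semidirect:
  assumes "group G" "subgroup N G" "subgroup H G"
    and conj: "\<And>h a. \<lbrakk>h \<in> H; a \<in> N\<rbrakk> \<Longrightarrow> h \<otimes>\<^bsub>G\<^esub> a \<otimes>\<^bsub>G\<^esub> inv\<^bsub>G\<^esub> h \<in> N"
    and triv: "N \<inter> H \<subseteq> {\<one>\<^bsub>G\<^esub>}"
  shows "(\<lambda>(a, h). a \<otimes>\<^bsub>G\<^esub> h) \<in>
    iso (semidirect (G\<lparr>carrier := N\<rparr>) (G\<lparr>carrier := H\<rparr>) (conjugation G N))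
        (G\<lparr>carrier := N <#>\<^bsub>G\<^esub> H\<rparr>)"
proof (rule isoI)
  interpret group G by fact
  interpret N: subgroup N G by fact
  interpret H: subgroup H G by fact
  let ?S = "semidirect (G\<lparr>carrier := N\<rparr>) (G\<lparr>carrier := H\<rparr>) (conjugation G N)"
  have S: "carrier ?S = N \<times> H"
    by (simp add: semidirect_def)
  show "(\<lambda>(a, h). a \<otimes>\<^bsub>G\<^esub> h) \<in> hom ?S (G\<lparr>carrier := N <#>\<^bsub>G\<^esub> H\<rparr>)"
    by (rule homI)
       (auto simp: semidirect_def set_mult_def conjugation_def m_assoc inv_solve_left')
  have "inj_on (\<lambda>(a, h). a \<otimes>\<^bsub>G\<^esub> h) (N \<times> H)"
  proof (rule inj_onI, clarsimp)
    fix a h b k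
    assume mem: "a \<in> N" "h \<in> H" "b \<in> N" "k \<in> H" and eq: "a \<otimes>\<^bsub>G\<^esub> h = b \<otimes>\<^bsub>G\<^esub> k"
    then have "inv\<^bsub>G\<^esub> b \<otimes>\<^bsub>G\<^esub> a = k \<otimes>\<^bsub>G\<^esub> inv\<^bsub>G\<^esub> h"
      by (metis N.mem_carrier H.mem_carrier inv_solve_left inv_solve_right m_assoc
          m_closed inv_closed)
    moreover have "inv\<^bsub>G\<^esub> b \<otimes>\<^bsub>G\<^esub> a \<in> N" "k \<otimes>\<^bsub>G\<^esub> inv\<^bsub>G\<^esub> h \<in> H"
      using mem by auto
    ultimately have "inv\<^bsub>G\<^esub> b \<otimes>\<^bsub>G\<^esub> a = \<one>\<^bsub>G\<^esub>"
      using triv by auto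
    then have "a = b"
      using mem by (metis N.mem_carrier inv_closed inv_equality inv_inv)
    then show "a = b \<and> h = k"
      using eq mem by simp
  qed
  moreover have "(\<lambda>(a, h). a \<otimes>\<^bsub>G\<^esub> h) ` (N \<times> H) = N <#>\<^bsub>G\<^esub> H"
    by (auto simp: set_mult_def)
  ultimately show "bij_betw (\<lambda>(a, h). a \<otimes>\<^bsub>G\<^esub> h) (carrier ?S)
      (carrier (G\<lparr>carrier := N <#>\<^bsub>G\<^esub> H\<rparr>))"
    by (simp add: S bij_betw_def)
qed

section \<open>Affine bijections\<close>

definition affine :: "nat \<Rightarrow> int \<Rightarrow> int \<Rightarrow> int \<Rightarrow> int" where
  "affine n \<nu> k = (\<lambda>x\<in>carrier (Z2n n). \<nu> \<otimes>\<^bsub>Z2n n\<^esub> x \<oplus>\<^bsub>Z2n n\<^esub> k)"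

lemma mod_affine: "(\<nu> * (c mod m) + d) mod m = (\<nu> * c + d) mod m" for m :: int
  by (metis mod_add_left_eq mod_mult_right_eq)

locale even_residues =
  fixes n :: nat
  assumes n_pos: "n > 0"

sublocale even_residues \<subseteq> residues "2 * int n" "Z2n n"
  using n_pos by unfold_locales simp

context even_residues
begin

abbreviation E :: "int set" where "E \<equiv> carrier (Z2n n)"
abbreviation Sym :: "(int \<Rightarrow> int) monoid" where "Sym \<equiv> BijGroup E"

lemma affine_closed [simp]:
  "\<lbrakk>\<nu> \<in> E; k \<in> E; x \<in> E\<rbrakk> \<Longrightarrow> affine n \<nu> k x \<in> E"
  by (simp add: affine_def)

lemma translation_eq_affine: "k \<in> E \<Longrightarrow> translation n k = affine n \<one>\<^bsub>Z2n n\<^esub> k"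
  by (auto simp: translation_def affine_def intro!: restrict_ext)

lemma scaling_eq_affine: "\<nu> \<in> E \<Longrightarrow> scaling n \<nu> = affine n \<nu> \<zero>\<^bsub>Z2n n\<^esub>"
  by (auto simp: scaling_def affine_def intro!: restrict_ext)

lemma compose_affine:
  assumes "\<nu> \<in> E" "k \<in> E" "\<mu> \<in> E" "l \<in> E"
  shows "compose E (affine n \<nu> k) (affine n \<mu> l) =
    affine n (\<nu> \<otimes>\<^bsub>Z2n n\<^esub> \<mu>) (\<nu> \<otimes>\<^bsub>Z2n n\<^esub> l \<oplus>\<^bsub>Z2n n\<^esub> k)"
  using assms
  by (auto simp: compose_def affine_def r_distr m_assoc a_assoc intro!: restrict_ext)

lemma affine_eq_iff:
  assumes "\<nu> \<in> E" "k \<in> E" "\<mu> \<in> E" "l \<in> E"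
  shows "affine n \<nu> k = affine n \<mu> l \<longleftrightarrow> \<nu> = \<mu> \<and> k = l"
proof
  assume eq: "affine n \<nu> k = affine n \<mu> l"
  have "k = l"
    using fun_cong[OF eq, of "\<zero>\<^bsub>Z2n n\<^esub>"] assms by (simp add: affine_def)
  moreover have "\<nu> \<oplus>\<^bsub>Z2n n\<^esub> k = \<mu> \<oplus>\<^bsub>Z2n n\<^esub> l"
    using fun_cong[OF eq, of "\<one>\<^bsub>Z2n n\<^esub>"] assms by (simp add: affine_def)
  ultimately show "\<nu> = \<mu> \<and> k = l"
    using assms by simp
qed simp

text \<open>
  A preimage of \<open>1 + k\<close> is an inverse of \<open>\<nu>\<close>; in the other direction cancelling \<open>\<nu>\<close> gives
  injectivity, which suffices on a finite set.
\<close>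
lemma affine_Bij_iff:
  assumes "\<nu> \<in> E" "k \<in> E"
  shows "affine n \<nu> k \<in> Bij E \<longleftrightarrow> \<nu> \<in> Units (Z2n n)"
proof
  assume "affine n \<nu> k \<in> Bij E"
  then have "affine n \<nu> k ` E = E"
    by (simp add: Bij_def bij_betw_def)
  then obtain x where x: "x \<in> E" "affine n \<nu> k x = \<one>\<^bsub>Z2n n\<^esub> \<oplus>\<^bsub>Z2n n\<^esub> k"
    using assms by (metis (no_types, lifting) add.m_closed image_iff one_closed)
  then have "\<nu> \<otimes>\<^bsub>Z2n n\<^esub> x = \<one>\<^bsub>Z2n n\<^esub>"
    using assms by (simp add: affine_def)
  then show "\<nu> \<in> Units (Z2n n)"
    using assms x(1) m_comm[of \<nu> x] by (auto simp: Units_def intro!: bexI[of _ x])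
next
  assume \<nu>: "\<nu> \<in> Units (Z2n n)"
  have "inj_on (affine n \<nu> k) E"
    using \<nu> assms by (intro inj_onI) (simp add: affine_def Units_l_cancel)
  moreover have "affine n \<nu> k ` E \<subseteq> E"
    using assms by auto
  ultimately have "bij_betw (affine n \<nu> k) E E"
    by (simp add: bij_betw_def endo_inj_surj)
  then show "affine n \<nu> k \<in> Bij E"
    by (simp add: Bij_def affine_def)
qed

lemma affine_Bij [simp]: "\<lbrakk>\<nu> \<in> Units (Z2n n); k \<in> E\<rbrakk> \<Longrightarrow> affine n \<nu> k \<in> Bij E"
  using affine_Bij_iff Units_closed by blast

lemma affine_mult [simp]:
  assumes "\<nu> \<in> Units (Z2n n)" "k \<in> E" "\<mu> \<in> Units (Z2n n)" "l \<in> E"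
  shows "affine n \<nu> k \<otimes>\<^bsub>Sym\<^esub> affine n \<mu> l =
    affine n (\<nu> \<otimes>\<^bsub>Z2n n\<^esub> \<mu>) (\<nu> \<otimes>\<^bsub>Z2n n\<^esub> l \<oplus>\<^bsub>Z2n n\<^esub> k)"
  using assms by (simp add: BijGroup_def compose_affine Units_closed)

lemma carrier_Aff: "carrier (Aff n) = (\<lambda>(\<nu>, k). affine n \<nu> k) ` (Units (Z2n n) \<times> E)"
proof -
  have "carrier (Aff n) = {f \<in> Bij E. \<exists>\<nu>\<in>E. \<exists>k\<in>E. f = affine n \<nu> k}"
    by (simp add: Aff_def affine_def)
  also have "\<dots> = (\<lambda>(\<nu>, k). affine n \<nu> k) ` (Units (Z2n n) \<times> E)"
    using affine_Bij_iff Units_closed by (auto simp: image_iff)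
  finally show ?thesis .
qed

lemma GL_eq: "GL n = Sym\<lparr>carrier := scaling n ` Units (Z2n n)\<rparr>"
proof -
  have "scaling n \<nu> \<in> Bij E \<longleftrightarrow> \<nu> \<in> Units (Z2n n)" if "\<nu> \<in> E" for \<nu>
    using that by (simp add: scaling_eq_affine affine_Bij_iff)
  then have "{f \<in> Bij E. \<exists>\<nu>\<in>E. f = scaling n \<nu>} = scaling n ` Units (Z2n n)"
    using Units_closed by auto
  then show ?thesis
    by (simp add: GL_def)
qed

lemma card_Units: "card (Units (Z2n n)) = totient (2 * n)"
proof -
  have "bij_betw int (totatives (2 * n)) (Units (Z2n n))"
    unfolding res_units_eq
  proof (rule bij_betwI[where g = nat])
    show "int \<in> totatives (2 * n) \<rightarrow> {x. 0 < x \<and> x < 2 * int n \<and> coprime x (2 * int n)}"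
    proof
      fix k assume k: "k \<in> totatives (2 * n)"
      then have "k \<noteq> 2 * n"
        using n_pos by (auto simp: totatives_def)
      moreover have "coprime (int k) (int (2 * n))"
        using k unfolding coprime_int_iff by (simp add: totatives_def)
      ultimately show "int k \<in> {x. 0 < x \<and> x < 2 * int n \<and> coprime x (2 * int n)}"
        using k by (auto simp: totatives_def)
    qed
    show "nat \<in> {x. 0 < x \<and> x < 2 * int n \<and> coprime x (2 * int n)} \<rightarrow> totatives (2 * n)"
    proof
      fix x assume x: "x \<in> {x. 0 < x \<and> x < 2 * int n \<and> coprime x (2 * int n)}"
      then have "coprime (int (nat x)) (int (2 * n))"
        by simp
      then have "coprime (nat x) (2 * n)"
        unfolding coprime_int_iff .
      then show "nat x \<in> totatives (2 * n)"
        using x by (auto simp: totatives_def)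
    qed
  qed auto
  then show ?thesis
    unfolding totient_def by (rule bij_betw_same_card[symmetric])
qed

lemma order_Aff: "order (Aff n) = 2 * n * totient (2 * n)"
proof -
  have "inj_on (\<lambda>(\<nu>, k). affine n \<nu> k) (Units (Z2n n) \<times> E)"
    using Units_closed by (auto simp: inj_on_def affine_eq_iff)
  then show ?thesis
    by (simp add: order_def carrier_Aff card_image card_cartesian_product card_Units
        res_carrier_eq nat_mult_distrib)
qed

section \<open>Translations and scalings\<close>

lemma translation_hom: "translation n \<in> hom (add_monoid (Z2n n)) Sym"
  by (rule homI) (auto simp: translation_eq_affine BijGroup_def compose_affine a_comm)

lemma scaling_hom: "scaling n \<in> hom (units_of (Z2n n)) Sym"
  by (rule homI)
     (auto simp: scaling_eq_affine BijGroup_def compose_affine Units_closed units_of_def)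

lemma subgroup_translations: "subgroup (translation n ` E) Sym"
proof -
  have "group_hom (add_monoid (Z2n n)) Sym (translation n)"
    by (intro group_hom.intro group_hom_axioms.intro a_group group_BijGroup translation_hom)
  then show ?thesis
    using group_hom.img_is_subgroup by fastforce
qed

lemma subgroup_scalings: "subgroup (scaling n ` Units (Z2n n)) Sym"
proof -
  have "group_hom (units_of (Z2n n)) Sym (scaling n)"
    by (intro group_hom.intro group_hom_axioms.intro units_group group_BijGroup scaling_hom)
  then show ?thesis
    using group_hom.img_is_subgroup by (fastforce simp: units_of_def)
qed

text \<open>
  Every residue is reached from \<open>0\<close> by adding \<open>1\<close>, so the positive powers of \<open>T\<^sub>1\<close> already
  exhaust the translations.
\<close>
lemma translation_group_eq: "translation_group n = Sym\<lparr>carrier := translation n ` E\<rparr>"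
proof -
  have one: "1 \<in> E" using one_closed by (simp add: res_one_eq)
  have T1: "translation n 1 \<in> carrier Sym"
    using hom_in_carrier[OF translation_hom] one by simp
  have "generate Sym {translation n 1} = translation n ` E"
  proof
    show "generate Sym {translation n 1} \<subseteq> translation n ` E"
      using group.generate_subgroup_incl[OF group_BijGroup _ subgroup_translations] one by blast
    have "translation n (int k) \<in> generate Sym {translation n 1}" if "int k < 2 * int n" for k
      using that
    proof (induction k)
      case 0
      have "translation n 0 = \<one>\<^bsub>Sym\<^esub>"
        using hom_one[OF translation_hom a_group group_BijGroup] by (simp add: res_zero_eq)
      then show ?case
        using generate.one[of Sym "{translation n 1}"] by simp
    next
      case (Suc k)
      then have "int k \<in> E" "int k \<oplus>\<^bsub>Z2n n\<^esub> 1 = int (Suc k)"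
        by (simp_all add: res_carrier_eq res_add_eq add.commute)
      then have "translation n (int (Suc k)) = translation n (int k) \<otimes>\<^bsub>Sym\<^esub> translation n 1"
        using hom_mult[OF translation_hom, of "int k" 1] one by simp
      then show ?case
        using Suc by (auto intro: generate.eng generate.incl)
    qed
    then show "translation n ` E \<subseteq> generate Sym {translation n 1}"
      by (auto simp: res_carrier_eq) (metis nonneg_int_cases zle_diff1_eq)
  qed
  then show ?thesis
    using T1 by (simp add: translation_group_def subgroup_generated_def)
qed

lemma scaling_group_eq: "scaling_group n = Sym\<lparr>carrier := scaling n ` Units (Z2n n)\<rparr>"
proof -
  have "carrier (scaling_group n) = scaling n ` Units (Z2n n)"
    using subgroup.carrier_subgroup_generated_subgroup[OF subgroup_scalings]
    by (simp add: scaling_group_def setcompr_eq_image)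
  then show ?thesis
    by (simp add: scaling_group_def subgroup_generated_def)
qed

lemma scaling_conjugates_translation:
  assumes \<nu>: "\<nu> \<in> Units (Z2n n)" and k: "k \<in> E"
  shows "scaling n \<nu> \<otimes>\<^bsub>Sym\<^esub> translation n k \<otimes>\<^bsub>Sym\<^esub> inv\<^bsub>Sym\<^esub> scaling n \<nu> =
    translation n (\<nu> \<otimes>\<^bsub>Z2n n\<^esub> k)"
proof -
  interpret Sym: group Sym by (rule group_BijGroup)
  have "scaling n \<nu> \<otimes>\<^bsub>Sym\<^esub> translation n k = translation n (\<nu> \<otimes>\<^bsub>Z2n n\<^esub> k) \<otimes>\<^bsub>Sym\<^esub> scaling n \<nu>"
    using \<nu> k by (simp add: scaling_eq_affine translation_eq_affine Units_closed)
  moreover have "scaling n \<nu> \<in> carrier Sym" "translation n (\<nu> \<otimes>\<^bsub>Z2n n\<^esub> k) \<in> carrier Sym"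
    using \<nu> k by (simp_all add: scaling_eq_affine translation_eq_affine Units_closed BijGroup_def)
  ultimately show ?thesis
    by (simp add: Sym.m_assoc)
qed

lemma scalings_normalize_translations:
  assumes "h \<in> scaling n ` Units (Z2n n)" "a \<in> translation n ` E"
  shows "h \<otimes>\<^bsub>Sym\<^esub> a \<otimes>\<^bsub>Sym\<^esub> inv\<^bsub>Sym\<^esub> h \<in> translation n ` E"
  using assms by (auto simp: scaling_conjugates_translation Units_closed)

lemma semidirect_data_translation_scaling:
  "semidirect_data (translation_group n) (scaling_group n) (scaling_conj n)"
  using semidirect_data_conjugation[OF group_BijGroup subgroup_translations subgroup_scalings
      scalings_normalize_translations]
  by (simp add: translation_group_eq scaling_group_eq)

lemma translations_Int_scalings:
  "translation n ` E \<inter> scaling n ` Units (Z2n n) \<subseteq> {\<one>\<^bsub>Sym\<^esub>}"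
proof
  fix f assume "f \<in> translation n ` E \<inter> scaling n ` Units (Z2n n)"
  then obtain k \<nu> where k: "k \<in> E" "f = translation n k"
    and \<nu>: "\<nu> \<in> Units (Z2n n)" "f = scaling n \<nu>"
    by auto
  then have "k = \<zero>\<^bsub>Z2n n\<^esub>"
    by (simp add: translation_eq_affine scaling_eq_affine affine_eq_iff Units_closed)
  then show "f \<in> {\<one>\<^bsub>Sym\<^esub>}"
    using hom_one[OF translation_hom a_group group_BijGroup] k by simp
qed

lemma carrier_Aff_eq_product:
  "carrier (Aff n) = translation n ` E <#>\<^bsub>Sym\<^esub> scaling n ` Units (Z2n n)"
proof -
  have "translation n ` E <#>\<^bsub>Sym\<^esub> scaling n ` Units (Z2n n) =
      (\<lambda>(\<nu>, k). translation n k \<otimes>\<^bsub>Sym\<^esub> scaling n \<nu>) ` (Units (Z2n n) \<times> E)"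
    by (auto simp: set_mult_def)
  also have "\<dots> = (\<lambda>(\<nu>, k). affine n \<nu> k) ` (Units (Z2n n) \<times> E)"
    by (rule image_cong)
       (auto simp: scaling_eq_affine translation_eq_affine Units_closed)
  finally show ?thesis
    by (simp add: carrier_Aff)
qed

lemma semidirect_translation_scaling_iso_Aff:
  "semidirect (translation_group n) (scaling_group n) (scaling_conj n) \<cong> Aff n"
proof -
  have "Aff n = Sym\<lparr>carrier := translation n ` E <#>\<^bsub>Sym\<^esub> scaling n ` Units (Z2n n)\<rparr>"
    using carrier_Aff_eq_product by (simp add: Aff_def)
  then show ?thesis
    using iso_internal_semidirect[OF group_BijGroup subgroup_translations subgroup_scalings
        scalings_normalize_translations translations_Int_scalings]
    by (simp add: translation_group_eq scaling_group_eq is_isoI)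
qed

lemma semidirect_data_Z2n_GL: "semidirect_data (add_monoid (Z2n n)) (GL n) (\<lambda>g. g)"
proof -
  have "scaling n \<nu> \<in> auto (add_monoid (Z2n n))" if \<nu>: "\<nu> \<in> Units (Z2n n)" for \<nu>
  proof -
    have "scaling n \<nu> \<in> hom (add_monoid (Z2n n)) (add_monoid (Z2n n))"
      using \<nu> by (intro homI) (auto simp: scaling_def r_distr Units_closed)
    then show ?thesis
      using \<nu> by (simp add: auto_def scaling_eq_affine Units_closed)
  qed
  then have "(\<lambda>g. g) \<in> hom (GL n) (AutoGroup (add_monoid (Z2n n)))"
    by (intro homI) (auto simp: GL_eq AutoGroup_def)
  moreover have "group (GL n)"
    unfolding GL_eq by (rule group.subgroup_imp_group[OF group_BijGroup subgroup_scalings])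
  ultimately show ?thesis
    unfolding semidirect_data_def by (intro conjI a_group)
qed

lemma to_affine_scaling:
  "\<lbrakk>\<nu> \<in> E; k \<in> E\<rbrakk> \<Longrightarrow> to_affine n (k, scaling n \<nu>) = affine n \<nu> k"
  by (auto simp: to_affine_def scaling_def affine_def intro!: restrict_ext)

lemma to_affine_iso: "to_affine n \<in> iso (Z2n_semidirect_GL n) (Aff n)"
proof (rule isoI)
  have S: "carrier (Z2n_semidirect_GL n) = E \<times> scaling n ` Units (Z2n n)"
    by (simp add: semidirect_def GL_eq)
  show "to_affine n \<in> hom (Z2n_semidirect_GL n) (Aff n)"
  proof (rule homI)
    fix x y assume "x \<in> carrier (Z2n_semidirect_GL n)" "y \<in> carrier (Z2n_semidirect_GL n)"
    then obtain k \<nu> l \<mu> where xy: "x = (k, scaling n \<nu>)" "y = (l, scaling n \<mu>)"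
      and mem: "k \<in> E" "l \<in> E" "\<nu> \<in> Units (Z2n n)" "\<mu> \<in> Units (Z2n n)"
      unfolding S by auto
    have "x \<otimes>\<^bsub>Z2n_semidirect_GL n\<^esub> y =
        (\<nu> \<otimes>\<^bsub>Z2n n\<^esub> l \<oplus>\<^bsub>Z2n n\<^esub> k, scaling n (\<nu> \<otimes>\<^bsub>Z2n n\<^esub> \<mu>))"
      using mem hom_mult[OF scaling_hom, of \<nu> \<mu>]
      by (simp add: xy semidirect_def GL_eq scaling_def a_comm Units_closed units_of_def)
    then show "to_affine n (x \<otimes>\<^bsub>Z2n_semidirect_GL n\<^esub> y) =
        to_affine n x \<otimes>\<^bsub>Aff n\<^esub> to_affine n y"
      using mem by (simp add: xy to_affine_scaling Units_closed Aff_def)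
  next
    fix x assume "x \<in> carrier (Z2n_semidirect_GL n)"
    then show "to_affine n x \<in> carrier (Aff n)"
      unfolding S by (force simp: to_affine_scaling Units_closed carrier_Aff)
  qed
  have "inj_on (to_affine n) (E \<times> scaling n ` Units (Z2n n))"
    by (auto simp: inj_on_def to_affine_scaling Units_closed affine_eq_iff)
  moreover have "to_affine n ` (E \<times> scaling n ` Units (Z2n n)) = carrier (Aff n)"
    by (force simp: to_affine_scaling Units_closed carrier_Aff)
  ultimately show "bij_betw (to_affine n) (carrier (Z2n_semidirect_GL n)) (carrier (Aff n))"
    unfolding bij_betw_def S by blast
qed

section \<open>Invariant functions of the dihedral action\<close>

text \<open>
  The automorphism must fix the type of both generators, rotation or reflection, because \<open>f\<close>
  carries the fixed points of \<open>g\<close> onto the fixed points of \<open>\<alpha> g\<close>: the reflection \<open>\<rho>\<^sup>a\<sigma>\<close> fixes \<open>a\<close>,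
  whereas a rotation other than the identity fixes nothing.
  Hence, modulo \<open>2n\<close>, \<open>f (x + 2) = f x + 2u\<close> and \<open>f (- x) = - f x + 2w\<close> for some \<open>u\<close> and \<open>w\<close>.
  The second equation at \<open>0\<close> reads \<open>2w = 2 f 0\<close>. Comparing \<open>f 1\<close> with \<open>f (- 1)\<close> through both
  equations then gives \<open>2u = 2 (f 1 - f 0)\<close>, so the step of \<open>f\<close> along evens and along odds
  is that of the affine map with the same values at \<open>0\<close> and \<open>1\<close>.
\<close>
lemma invariant_imp_affine:
  assumes f: "f \<in> Bij E" and \<alpha>: "\<alpha> \<in> auto (dihedral n)"
    and tw: "twisted_invariant (dihedral n) E (dihedral_act n) \<alpha> f"
  shows "\<exists>\<nu>\<in>E. \<exists>k\<in>E. f = affine n \<nu> k"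
proof -
  define m where "m = 2 * int n"
  have m: "m > 0" using n_pos by (simp add: m_def)
  interpret D: group "dihedral n" by (rule group_dihedral[OF n_pos])
  have E: "x \<in> E \<longleftrightarrow> 0 \<le> x \<and> x < m" for x
    by (auto simp: res_carrier_eq m_def)
  have modE [simp]: "x mod m \<in> E" for x
    using m by (simp add: E)
  have fE [simp]: "f x \<in> E" if "x \<in> E" for x
    using Bij_imp_funcset[OF f] that by auto
  have \<alpha>_hom: "\<alpha> \<in> hom (dihedral n) (dihedral n)"
    and \<alpha>_inj: "inj_on \<alpha> (carrier (dihedral n))"
    using \<alpha> by (auto simp: auto_def Bij_def bij_betw_def)
  have \<alpha>_one: "\<alpha> \<one>\<^bsub>dihedral n\<^esub> = \<one>\<^bsub>dihedral n\<^esub>"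
    using hom_one[OF \<alpha>_hom D.group_axioms D.group_axioms] .
  have act: "dihedral_act n (a, s) x = ((if s then - x else x) + 2 * a) mod m" if "x \<in> E" for a s x
    using that by (simp add: dihedral_act_def m_def)
  have fact: "f (dihedral_act n g x) = dihedral_act n (\<alpha> g) (f x)"
    if "g \<in> carrier (dihedral n)" "x \<in> E" for g x
    using tw that by (simp add: twisted_invariant_def)

  have act_rho: "dihedral_act n (rho n) x = (x + 2) mod m" if "x \<in> E" for x
    using that add_double_mod[of x 1 "int n"] by (simp add: act rho_def m_def)
  have act_sigma: "dihedral_act n sigma x = (- x) mod m" if "x \<in> E" for x
    using that by (simp add: act sigma_def)

  obtain u where u: "\<alpha> (rho n) = (u, False)"
  proof (cases "\<alpha> (rho n)")
    case (Pair u t)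
    \<comment> \<open>The reflection \<open>\<rho>\<^sup>u\<sigma>\<close> fixes \<open>u\<close>, so \<open>\<rho>\<close> would fix the preimage of \<open>u\<close>, which happens
      only if \<open>\<rho>\<close> is trivial.\<close>
    have "\<not> t"
    proof
      assume t
      have "f ` E = E"
        using f by (simp add: Bij_def bij_betw_def)
      then obtain x where x: "x \<in> E" "f x = u mod m"
        using modE by (metis imageE)
      have "f ((x + 2) mod m) = dihedral_act n (u, t) (u mod m)"
        using fact[OF rho_sigma_carrier(1)[OF n_pos] x(1)] x Pair by (simp add: act_rho)
      also have "\<dots> = (- (u mod m) + 2 * u) mod m"
        using \<open>t\<close> by (simp add: act)
      also have "\<dots> = (- u + 2 * u) mod m"
        by (metis mod_add_left_eq mod_minus_eq)
      also have "\<dots> = f x"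
        using x by simp
      finally have "(x + 2) mod m = x"
        using f x by (auto simp: Bij_def bij_betw_def inj_on_def)
      then have "(x + 2) mod m = x mod m"
        using x(1) by (simp add: E)
      then have "m dvd 2"
        by (simp add: mod_eq_dvd_iff)
      then have "n = 1"
        using n_pos by (auto simp: m_def)
      then have "rho n = \<one>\<^bsub>dihedral n\<^esub>"
        by (simp add: rho_def dihedral_simps)
      then show False
        using \<alpha>_one Pair \<open>t\<close> by (simp add: dihedral_simps)
    qed
    then show ?thesis using Pair that by simp
  qed

  obtain w where w: "\<alpha> sigma = (w, True)"
  proof (cases "\<alpha> sigma")
    case (Pair w t)
    \<comment> \<open>As \<open>\<sigma>\<close> fixes \<open>0\<close>, its image fixes \<open>f 0\<close>; a rotation with a fixed point is trivial.\<close>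
    have t
    proof (rule ccontr)
      assume "\<not> t"
      have 0: "0 \<in> E" using m by (simp add: E)
      have "(f 0 + 2 * w) mod m = f 0"
        using fact[OF rho_sigma_carrier(2)[OF n_pos] 0] Pair \<open>\<not> t\<close> 0
        by (simp add: act_sigma act)
      then have "(f 0 + 2 * w) mod m = f 0 mod m"
        using fE[OF 0] by (simp add: E)
      then have "int n dvd w"
        by (simp add: mod_eq_dvd_iff m_def)
      moreover have "0 \<le> w" "w < int n"
        using hom_in_carrier[OF \<alpha>_hom rho_sigma_carrier(2)[OF n_pos]] Pair
        by (simp_all add: dihedral_simps)
      ultimately have "w = 0"
        using zdvd_imp_le by fastforce
      then have "\<alpha> sigma = \<alpha> \<one>\<^bsub>dihedral n\<^esub>"
        using Pair \<open>\<not> t\<close> \<alpha>_one by (simp add: dihedral_simps)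
      then have "sigma = \<one>\<^bsub>dihedral n\<^esub>"
        using inj_onD[OF \<alpha>_inj] rho_sigma_carrier(2)[OF n_pos] by blast
      then show False by (simp add: sigma_def dihedral_simps)
    qed
    then show ?thesis using Pair that by simp
  qed

  \<comment> \<open>Extending \<open>f\<close> periodically to all integers turns the equations into congruences.\<close>
  define F where "F x = f (x mod m)" for x
  have step: "[F (x + 2) = F x + 2 * u] (mod m)" for x
    using fact[OF rho_sigma_carrier(1)[OF n_pos] modE, of x] u
    by (simp add: act_rho act F_def cong_def mod_simps)
  have refl: "[F (- x) = - F x + 2 * w] (mod m)" for x
    using fact[OF rho_sigma_carrier(2)[OF n_pos] modE, of x] w
    by (simp add: act_sigma act F_def cong_def mod_simps)

  have at_0: "m dvd F 0 - (- F 0 + 2 * w)" and at_1: "m dvd F (- 1) - (- F 1 + 2 * w)"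
    and across: "m dvd F 1 - (F (- 1) + 2 * u)"
    using refl[of 0] refl[of 1] step[of "- 1"] by (simp_all add: cong_iff_dvd_diff)
  have "m dvd (F 1 - (F (- 1) + 2 * u)) + (F (- 1) - (- F 1 + 2 * w))
      - (F 0 - (- F 0 + 2 * w))"
    by (rule dvd_diff[OF dvd_add[OF across at_1] at_0])
  then have two_u: "m dvd 2 * (F 1 - F 0) - 2 * u"
    by (simp add: algebra_simps)

  have "[F (int k) = (F 1 - F 0) * int k + F 0] (mod m)" for k :: nat
  proof (induction k rule: induct_nat_012)
    case (ge2 k)
    have "m dvd (F (int k + 2) - (F (int k) + 2 * u))
        + (F (int k) - ((F 1 - F 0) * int k + F 0)) - (2 * (F 1 - F 0) - 2 * u)"
      using step[of "int k"] ge2(1) unfolding cong_iff_dvd_diff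
      by (intro dvd_diff[OF dvd_add two_u])
    then show ?case
      by (simp add: cong_iff_dvd_diff algebra_simps)
  qed (simp_all)
  then have "f x = affine n ((F 1 - F 0) mod m) (F 0) x" if "x \<in> E" for x
  proof -
    have "f x mod m = ((F 1 - F 0) * x + F 0) mod m"
      using \<open>\<And>k. [F (int k) = _] (mod m)\<close>[of "nat x"] that by (simp add: cong_def F_def E)
    also have "\<dots> = ((F 1 - F 0) mod m * x + F 0) mod m"
      by (metis mod_add_left_eq mod_mult_left_eq)
    also have "\<dots> = affine n ((F 1 - F 0) mod m) (F 0) x"
      using that by (simp add: affine_def res_add_eq res_mult_eq m_def mod_add_left_eq)
    finally show ?thesis
      using fE[OF that] by (simp add: E)
  qed
  moreover have "f \<in> extensional E"
    using f by (simp add: Bij_def)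
  ultimately have "f = affine n ((F 1 - F 0) mod m) (F 0)"
    by (intro extensionalityI[of _ E]) (auto simp: affine_def)
  moreover have "F 0 \<in> E"
    unfolding F_def by (rule fE[OF modE])
  ultimately show ?thesis
    using modE by blast
qed

text \<open>
  Conjugating \<open>x \<mapsto> x + 2a\<close> and \<open>x \<mapsto> - x + 2a\<close> by \<open>x \<mapsto> \<nu> x + k\<close> gives \<open>x \<mapsto> x + 2 \<nu> a\<close> and
  \<open>x \<mapsto> - x + 2 (\<nu> a + k)\<close>, which dictates the automorphism; it is injective because \<open>\<nu>\<close> is
  also a unit modulo \<open>n\<close>.
\<close>
lemma affine_invariant:
  assumes \<nu>: "\<nu> \<in> Units (Z2n n)" and k: "k \<in> E"
  shows "\<exists>\<alpha>\<in>auto (dihedral n). twisted_invariant (dihedral n) E (dihedral_act n) \<alpha> (affine n \<nu> k)"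
proof -
  define \<alpha> where "\<alpha> = (\<lambda>(a, s)\<in>carrier (dihedral n).
    ((\<nu> * a + (if s then k else 0)) mod int n, s))"
  have cop: "coprime \<nu> (int n)"
    using \<nu> by (auto simp: res_units_eq)
  have \<alpha>_apply: "\<alpha> (a, s) = ((\<nu> * a + (if s then k else 0)) mod int n, s)"
    if "(a, s) \<in> carrier (dihedral n)" for a s
    using that by (simp add: \<alpha>_def)
  have \<alpha>_closed: "\<alpha> g \<in> carrier (dihedral n)" if "g \<in> carrier (dihedral n)" for g
    using that n_pos by (auto simp: \<alpha>_def dihedral_simps)
  have "\<alpha> \<in> hom (dihedral n) (dihedral n)"
  proof (rule homI)
    fix g h assume g: "g \<in> carrier (dihedral n)" and h: "h \<in> carrier (dihedral n)"
    obtain a s b t where gh: "g = (a, s)" "h = (b, t)" by fastforce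
    have "(c mod int n, r) \<in> carrier (dihedral n)" for c r
      using n_pos by (simp add: dihedral_simps)
    then show "\<alpha> (g \<otimes>\<^bsub>dihedral n\<^esub> h) = \<alpha> g \<otimes>\<^bsub>dihedral n\<^esub> \<alpha> h"
      using g h unfolding gh
      by (simp add: dihedral_simps(3) \<alpha>_apply mod_affine mod_simps) (simp add: algebra_simps)
  qed (rule \<alpha>_closed)
  moreover have "inj_on \<alpha> (carrier (dihedral n))"
  proof (rule inj_onI)
    fix g h assume g: "g \<in> carrier (dihedral n)" and h: "h \<in> carrier (dihedral n)"
      and eq: "\<alpha> g = \<alpha> h"
    obtain a s b t where gh: "g = (a, s)" "h = (b, t)" by fastforce
    have st: "s = t" and ab: "[\<nu> * a + (if s then k else 0) = \<nu> * b + (if s then k else 0)] (mod int n)"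
      using eq g h by (auto simp: gh \<alpha>_apply cong_def)
    have "[a = b] (mod int n)"
      using ab cop by (simp only: cong_add_rcancel cong_mult_lcancel)
    then show "g = h"
      using g h st by (simp add: gh dihedral_simps cong_def)
  qed
  ultimately have "\<alpha> \<in> auto (dihedral n)"
    using \<alpha>_closed
    by (auto simp: auto_def Bij_def bij_betw_def endo_inj_surj dihedral_simps(1) image_subset_iff
        \<alpha>_def)
  moreover have "twisted_invariant (dihedral n) E (dihedral_act n) \<alpha> (affine n \<nu> k)"
    unfolding twisted_invariant_def
  proof (intro ballI)
    fix g x assume g: "g \<in> carrier (dihedral n)" and x: "x \<in> E"
    obtain a s where gas: "g = (a, s)" by fastforce
    let ?m = "2 * int n"
    have aff: "affine n \<nu> k y = (\<nu> * y + k) mod ?m" if "y \<in> E" for y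
      using that by (simp add: affine_def res_add_eq res_mult_eq mod_simps)
    have act: "dihedral_act n (b, r) y = ((if r then - y else y) + 2 * b) mod ?m" if "y \<in> E" for b r y
      using that by (simp add: dihedral_act_def)
    have "affine n \<nu> k (dihedral_act n g x) =
        (\<nu> * ((if s then - x else x) + 2 * a) + k) mod ?m"
      using x by (simp add: gas act aff mod_affine)
    also have "\<dots> = ((if s then - (\<nu> * x + k) else \<nu> * x + k)
        + 2 * (\<nu> * a + (if s then k else 0))) mod ?m"
      by (simp add: algebra_simps)
    also have "\<dots> = ((if s then - ((\<nu> * x + k) mod ?m) else (\<nu> * x + k) mod ?m)
        + 2 * ((\<nu> * a + (if s then k else 0)) mod int n)) mod ?m"
      unfolding add_double_mod by (simp add: mod_simps)
    also have "\<dots> = dihedral_act n (\<alpha> g) (affine n \<nu> k x)"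
      using x g by (simp add: gas \<alpha>_apply act aff)
    finally show "affine n \<nu> k (dihedral_act n g x) = dihedral_act n (\<alpha> g) (affine n \<nu> k x)" .
  qed
  ultimately show ?thesis by blast
qed

lemma dihedral_S_invariant_group_eq_Aff: "dihedral_S_invariant_group n = Aff n"
proof -
  have "{f \<in> Bij E. \<exists>\<alpha>\<in>auto (dihedral n).
      twisted_invariant (dihedral n) E (dihedral_act n) \<alpha> f} = carrier (Aff n)"
  proof (intro equalityI subsetI)
    fix f assume "f \<in> {f \<in> Bij E. \<exists>\<alpha>\<in>auto (dihedral n).
      twisted_invariant (dihedral n) E (dihedral_act n) \<alpha> f}"
    then obtain \<nu> k where "f \<in> Bij E" "\<nu> \<in> E" "k \<in> E" "f = affine n \<nu> k"
      using invariant_imp_affine by blast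
    then show "f \<in> carrier (Aff n)"
      by (auto simp: carrier_Aff affine_Bij_iff)
  next
    fix f assume "f \<in> carrier (Aff n)"
    then show "f \<in> {f \<in> Bij E. \<exists>\<alpha>\<in>auto (dihedral n).
      twisted_invariant (dihedral n) E (dihedral_act n) \<alpha> f}"
      using affine_invariant by (auto simp: carrier_Aff)
  qed
  then show ?thesis
    by (simp add: dihedral_S_invariant_group_def S_invariant_group_def Aff_def)
qed

end

theorem corollary3p24:
  fixes n :: nat
  assumes "n > 0"
  shows "semidirect_data (translation_group n) (scaling_group n) (scaling_conj n)
    \<and> semidirect_data (add_monoid (Z2n n)) (GL n) (\<lambda>g. g)
    \<and> dihedral_S_invariant_group n \<cong>
        semidirect (translation_group n) (scaling_group n) (scaling_conj n)
    \<and> semidirect (translation_group n) (scaling_group n) (scaling_conj n) \<cong>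
        Z2n_semidirect_GL n
    \<and> to_affine n \<in> iso (Z2n_semidirect_GL n) (Aff n)
    \<and> order (dihedral_S_invariant_group n) = 2 * n * totient (2 * n)"
proof -
  interpret even_residues n using assms by unfold_locales
  note TS = semidirect_translation_scaling_iso_Aff
  have "Aff n \<cong> semidirect (translation_group n) (scaling_group n) (scaling_conj n)"
    by (rule group.iso_sym[OF group_semidirect[OF semidirect_data_translation_scaling] TS])
  moreover have "Aff n \<cong> Z2n_semidirect_GL n"
    by (rule group.iso_sym[OF group_semidirect[OF semidirect_data_Z2n_GL] is_isoI[OF to_affine_iso]])
  ultimately show ?thesis
    using semidirect_data_translation_scaling semidirect_data_Z2n_GL to_affine_iso order_Aff
      iso_trans[OF TS]
    by (simp add: dihedral_S_invariant_group_eq_Aff)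
qed

end
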